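(* Let $n\ge3$ and let $\alpha_{ij}$ ($1\le i<j\le n$) be indeterminates. Let \[ P(x_1,\dots,x_n)=x_1^2+\cdots+x_n^2+\sum_{i<j}\alpha_{ij}x_ix_j, \] and for $i\in\{1,\dots,n\}$ define the rational transformation \[ F_i:(x_1,\dots,x_n)\mapsto\Bigl(x_1,\dots,x_{i-1},\frac{P|_{x_i=0}}{x_i},x_{i+1},\dots,x_n\Bigr). \] Then for any sequence of indices $i_1,\dots,i_m\in\{1,\dots,n\}$, the composition $G=F_{i_1}\circ\cdots\circ F_{i_m}$ has the form $G(x)=(G_1(x),\dots,G_n(x))$ where $G_1,\dots,G_n$ are Laurent polynomials in $x_1,\dots,x_n$ with coefficients in $\mathbb{Z}[\alpha_{ij}: i<j]$. *)

theory Defs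
  imports
    "HOL-Library.Poly_Mapping"
    "HOL-Library.Product_Lexorder"
    "HOL-Computational_Algebra.Polynomial_Factorial"
begin

text \<open>
  Polynomials are finitely supported functions on exponent vectors. The variables
  \<open>x\<^sub>k\<close> are indexed by naturals and the indeterminates \<open>\<alpha>\<^sub>i\<^sub>j\<close> by pairs of naturals; restrictions
  to \<open>x\<^sub>1, \<dots>, x\<^sub>n\<close> and to \<open>1 \<le> i < j \<le> n\<close> are imposed where they matter. The order on pairs only
  serves to make the polynomial rings integral domains.
\<close>

type_synonym coeff = "((nat \<times> nat) \<Rightarrow>\<^sub>0 nat) \<Rightarrow>\<^sub>0 int"
type_synonym xpoly = "(nat \<Rightarrow>\<^sub>0 nat) \<Rightarrow>\<^sub>0 coeff"
type_synonym ratfun = "xpoly fract"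

definition index_pairs :: "nat \<Rightarrow> (nat \<times> nat) set" where
  "index_pairs n = {(i, j). 1 \<le> i \<and> i < j \<and> j \<le> n}"

definition alpha :: "nat \<times> nat \<Rightarrow> coeff" where
  "alpha ij = Poly_Mapping.single (Poly_Mapping.single ij 1) 1"

text \<open>The subring \<open>\<int>[\<alpha>\<^sub>i\<^sub>j : 1 \<le> i < j \<le> n]\<close>.\<close>

definition alpha_ring :: "nat \<Rightarrow> coeff set" where
  "alpha_ring n = {c. \<forall>m \<in> Poly_Mapping.keys c. Poly_Mapping.keys m \<subseteq> index_pairs n}"

definition pconst :: "coeff \<Rightarrow> xpoly" where
  "pconst c = Poly_Mapping.single 0 c"

definition pvar :: "nat \<Rightarrow> xpoly" where
  "pvar k = Poly_Mapping.single (Poly_Mapping.single k 1) 1"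

definition rconst :: "coeff \<Rightarrow> ratfun" where
  "rconst c = to_fract (pconst c)"

definition rvar :: "nat \<Rightarrow> ratfun" where
  "rvar k = to_fract (pvar k)"

text \<open>Substitution \<open>x\<^sub>k \<mapsto> H k\<close> of rational functions into a polynomial.\<close>

definition poly_subst :: "(nat \<Rightarrow> ratfun) \<Rightarrow> xpoly \<Rightarrow> ratfun" where
  "poly_subst H p =
     (\<Sum>m \<in> Poly_Mapping.keys p. rconst (Poly_Mapping.lookup p m) *
        (\<Prod>k \<in> Poly_Mapping.keys m. H k ^ Poly_Mapping.lookup m k))"

text \<open>
  \<open>rat_subst H f g\<close>: substituting \<open>H\<close> into the rational function \<open>f\<close> is meaningful (some fraction
  representing \<open>f\<close> has a denominator that does not vanish under the substitution) and yields \<open>g\<close>.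
\<close>

definition rat_subst :: "(nat \<Rightarrow> ratfun) \<Rightarrow> ratfun \<Rightarrow> ratfun \<Rightarrow> bool" where
  "rat_subst H f g \<longleftrightarrow>
     (\<exists>p q. q \<noteq> 0 \<and> f = Fract p q \<and> poly_subst H q \<noteq> 0 \<and> g = poly_subst H p / poly_subst H q)"

text \<open>
  A rational transformation of \<open>(x\<^sub>1, \<dots>, x\<^sub>n)\<close> is given by its components \<open>1, \<dots>, n\<close>; the
  components outside this range are those of the identity. The composite \<open>F \<circ> H\<close> is \<open>None\<close> when
  a denominator of \<open>F\<close> vanishes identically on the image of \<open>H\<close>.
\<close>

type_synonym ratmap = "nat \<Rightarrow> ratfun"

definition ratmap_comp :: "ratmap \<Rightarrow> ratmap \<Rightarrow> ratmap option" where
  "ratmap_comp F H =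
     (if \<forall>k. \<exists>g. rat_subst H (F k) g then Some (\<lambda>k. THE g. rat_subst H (F k) g) else None)"

text \<open>\<open>[F\<^sub>1, \<dots>, F\<^sub>m] \<mapsto> F\<^sub>1 \<circ> (\<dots> \<circ> (F\<^sub>m \<circ> id))\<close>\<close>

definition ratmap_comp_list :: "ratmap list \<Rightarrow> ratmap option" where
  "ratmap_comp_list Fs = foldr (\<lambda>F G. Option.bind G (ratmap_comp F)) Fs (Some rvar)"

definition P_poly :: "nat \<Rightarrow> xpoly" where
  "P_poly n = (\<Sum>i = 1..n. pvar i ^ 2) +
         (\<Sum>(i, j) \<in> index_pairs n. pconst (alpha (i, j)) * pvar i * pvar j)"

definition F_map :: "nat \<Rightarrow> nat \<Rightarrow> ratmap" where
  "F_map n i = rvar(i := poly_subst (rvar(i := 0)) (P_poly n) / rvar i)"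

text \<open>
  Laurent polynomials in \<open>x\<^sub>1, \<dots>, x\<^sub>n\<close> over \<open>\<int>[\<alpha>\<^sub>i\<^sub>j : 1 \<le> i < j \<le> n]\<close>, as elements of the field of
  rational functions.
\<close>

definition laurent_polys :: "nat \<Rightarrow> ratfun set" where
  "laurent_polys n =
     {f. \<exists>(E :: (nat \<Rightarrow> int) set) c. finite E \<and> (\<forall>e \<in> E. c e \<in> alpha_ring n) \<and>
           f = (\<Sum>e \<in> E. rconst (c e) * (\<Prod>k = 1..n. rvar k powi e k))}"

end

theory Submission
  imports Defs
begin

text \<open>
  With \<open>L\<^sub>i = \<Sum>\<^bsub>j\<noteq>i\<^esub> \<alpha>\<^sub>i\<^sub>j x\<^sub>j\<close> (where \<open>\<alpha>\<^sub>j\<^sub>i = \<alpha>\<^sub>i\<^sub>j\<close>) one has \<open>P = x\<^sub>i\<^sup>2 + x\<^sub>i L\<^sub>i + P|\<^bsub>x\<^sub>i=0\<^esub>\<close>, so the new coordinate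
  \<open>x\<^sub>i' = P|\<^bsub>x\<^sub>i=0\<^esub> / x\<^sub>i\<close> satisfies \<open>P / x\<^sub>i = x\<^sub>i + L\<^sub>i + x\<^sub>i'\<close>. This is symmetric in \<open>x\<^sub>i\<close> and \<open>x\<^sub>i'\<close>;
  hence \<open>c = P / (x\<^sub>1 \<cdots> x\<^sub>n)\<close> is invariant under every \<open>F\<^sub>i\<close>, and
  \<open>x\<^sub>i' = c \<Prod>\<^bsub>j\<noteq>i\<^esub> x\<^sub>j - L\<^sub>i - x\<^sub>i\<close>. By induction all components of a composite are polynomials in
  \<open>x\<^sub>1, \<dots>, x\<^sub>n\<close> and the Laurent polynomial \<open>c\<close>. The composites are defined because the rational
  functions admit a field ordering in which all \<open>x\<^sub>k\<close> and \<open>\<alpha>\<^sub>i\<^sub>j\<close> are positive, so that all components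
  stay positive.
\<close>

section \<open>Ordered rings of polynomial mappings\<close>

text \<open>The order is lexicographic: the sign of \<open>f\<close> is that of its coefficient at
  the least exponent.\<close>

lemma poly_mapping_pos_iff:
  fixes f :: "'a::linorder \<Rightarrow>\<^sub>0 'b::{zero,linorder}"
  shows "0 < f \<longleftrightarrow> (\<exists>k. 0 < Poly_Mapping.lookup f k \<and> (\<forall>l<k. Poly_Mapping.lookup f l = 0))"
  by transfer (auto simp: less_fun_def)

text \<open>The lowest term of a product is the product of the lowest terms: by strict monotonicity
  of addition, every other pair of exponents has a larger sum.\<close>

lemma poly_mapping_mult_pos:
  fixes f g :: "'a::{ordered_cancel_comm_monoid_add,linorder} \<Rightarrow>\<^sub>0 'b::linordered_idom"
  assumes "0 < f" "0 < g"
  shows "0 < f * g"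
proof -
  obtain k where k: "0 < Poly_Mapping.lookup f k" "\<And>a. a < k \<Longrightarrow> Poly_Mapping.lookup f a = 0"
    using assms(1) by (auto simp: poly_mapping_pos_iff)
  obtain l where l: "0 < Poly_Mapping.lookup g l" "\<And>b. b < l \<Longrightarrow> Poly_Mapping.lookup g b = 0"
    using assms(2) by (auto simp: poly_mapping_pos_iff)
  define f' where "f' = f - Poly_Mapping.single k (Poly_Mapping.lookup f k)"
  define g' where "g' = g - Poly_Mapping.single l (Poly_Mapping.lookup g l)"
  have keys_f': "k < a" if "a \<in> Poly_Mapping.keys f'" for a
    using that k(2)[of a] unfolding f'_def
    by (cases a k rule: linorder_cases) (auto simp: in_keys_iff lookup_minus lookup_single)
  have keys_g': "l < b" if "b \<in> Poly_Mapping.keys g'" for b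
    using that l(2)[of b] unfolding g'_def
    by (cases b l rule: linorder_cases) (auto simp: in_keys_iff lookup_minus lookup_single)
  have keys_g: "l \<le> b" if "b \<in> Poly_Mapping.keys g" for b
    using that l(2)[of b] by (meson in_keys_iff not_le_imp_less)
  \<comment> \<open>\<open>r\<close> collects all products in which at least one factor is not a
    lowest term.\<close>
  define r where "r = Poly_Mapping.single k (Poly_Mapping.lookup f k) * g' + f' * g"
  have keys_r: "k + l < m" if m: "m \<in> Poly_Mapping.keys r" for m
  proof -
    consider "m \<in> Poly_Mapping.keys (Poly_Mapping.single k (Poly_Mapping.lookup f k) * g')"
      | "m \<in> Poly_Mapping.keys (f' * g)"
      using subsetD[OF keys_add m[unfolded r_def]] by blast
    then show ?thesis
    proof cases
      case 1
      then obtain a b where ab: "m = a + b" "b \<in> Poly_Mapping.keys g'"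
        "a \<in> Poly_Mapping.keys (Poly_Mapping.single k (Poly_Mapping.lookup f k))"
        using keys_mult by blast
      then have "a = k"
        by (simp split: if_splits)
      then show ?thesis
        using ab keys_g' by (simp add: add_strict_left_mono)
    next
      case 2
      then obtain a b where "m = a + b" "a \<in> Poly_Mapping.keys f'" "b \<in> Poly_Mapping.keys g"
        using keys_mult by blast
      then show ?thesis
        using keys_f' keys_g by (simp add: add_less_le_mono)
    qed
  qed
  have "f * g = Poly_Mapping.single k (Poly_Mapping.lookup f k) * g + f' * g"
    by (simp add: f'_def left_diff_distrib)
  also have "\<dots> = Poly_Mapping.single k (Poly_Mapping.lookup f k)
      * Poly_Mapping.single l (Poly_Mapping.lookup g l) + r"
    by (simp add: r_def g'_def right_diff_distrib)
  finally have fg: "f * g =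
      Poly_Mapping.single (k + l) (Poly_Mapping.lookup f k * Poly_Mapping.lookup g l) + r"
    by (simp only: mult_single)
  have "Poly_Mapping.lookup r m = 0" if "m \<le> k + l" for m
    using keys_r that by (metis in_keys_iff leD)
  then show ?thesis
    unfolding poly_mapping_pos_iff fg using k(1) l(1)
    by (intro exI[of _ "k + l"]) (auto simp: lookup_add lookup_single)
qed

text \<open>Used twice, first for the \<alpha>-polynomials over the integers and then for the
  x-polynomials over those; the fraction field \<open>ratfun\<close> thereby becomes an ordered
  field.\<close>

instantiation poly_mapping ::
  ("{ordered_cancel_comm_monoid_add,linorder}", linordered_idom) linordered_idom
begin

definition abs_poly_mapping :: "('a \<Rightarrow>\<^sub>0 'b) \<Rightarrow> 'a \<Rightarrow>\<^sub>0 'b" where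
  "abs_poly_mapping f = (if f < 0 then - f else f)"

definition sgn_poly_mapping :: "('a \<Rightarrow>\<^sub>0 'b) \<Rightarrow> 'a \<Rightarrow>\<^sub>0 'b" where
  "sgn_poly_mapping f = (if f = 0 then 0 else if 0 < f then 1 else - 1)"

instance
proof
  fix a b c :: "'a \<Rightarrow>\<^sub>0 'b"
  assume "a < b" "0 < c"
  then have "0 < c * (b - a)"
    by (intro poly_mapping_mult_pos) auto
  then show "c * a < c * b"
    by (simp add: algebra_simps)
qed (auto simp: abs_poly_mapping_def sgn_poly_mapping_def)

end

lemma poly_mapping_single_pos:
  fixes c :: "'b::{zero,linorder}" and k :: "'a::linorder"
  assumes "0 < c"
  shows "0 < Poly_Mapping.single k c"
  using assms by (auto simp: poly_mapping_pos_iff lookup_single intro!: exI[of _ k])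

lemma to_fract_pos: "0 < p \<Longrightarrow> 0 < to_fract p" for p :: "'a::linordered_idom"
  by (simp add: to_fract_def Zero_fract_def)

lemma rvar_pos: "0 < rvar k"
  by (simp add: rvar_def pvar_def to_fract_pos poly_mapping_single_pos)

lemma rconst_alpha_pos: "0 < rconst (alpha p)"
  by (simp add: rconst_def pconst_def alpha_def to_fract_pos poly_mapping_single_pos)

lemma rvar_nonzero: "rvar k \<noteq> 0"
  using rvar_pos[of k] by simp

section \<open>Substitution\<close>

lemma rconst_0 [simp]: "rconst 0 = 0"
  by (simp add: rconst_def pconst_def)

lemma rconst_1 [simp]: "rconst 1 = 1"
  by (simp add: rconst_def pconst_def)

lemma rconst_add: "rconst (a + b) = rconst a + rconst b"
  by (simp add: rconst_def pconst_def single_add)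

lemma rconst_mult: "rconst (a * b) = rconst a * rconst b"
  by (simp add: rconst_def pconst_def mult_single flip: to_fract_mult)

lemma rconst_uminus: "rconst (- a) = - rconst a"
  by (simp add: rconst_def pconst_def single_uminus)

lemma poly_subst_0 [simp]: "poly_subst H 0 = 0"
  by (simp add: poly_subst_def)

lemma poly_subst_add: "poly_subst H (p + q) = poly_subst H p + poly_subst H q"
  unfolding poly_subst_def
  by (rule setsum_keys_plus_distrib) (auto simp: rconst_add distrib_right)

lemma poly_subst_sum: "poly_subst H (sum f A) = (\<Sum>a\<in>A. poly_subst H (f a))"
  by (induction A rule: infinite_finite_induct) (auto simp: poly_subst_add)

lemma poly_subst_single:
  "poly_subst H (Poly_Mapping.single m c) =
     rconst c * (\<Prod>k\<in>Poly_Mapping.keys m. H k ^ Poly_Mapping.lookup m k)"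
  by (simp add: poly_subst_def)

lemma prod_keys_add:
  fixes H :: "'a \<Rightarrow> 'b::comm_monoid_mult" and m m' :: "'a \<Rightarrow>\<^sub>0 nat"
  shows "(\<Prod>k\<in>Poly_Mapping.keys (m + m'). H k ^ Poly_Mapping.lookup (m + m') k) =
    (\<Prod>k\<in>Poly_Mapping.keys m. H k ^ Poly_Mapping.lookup m k) *
    (\<Prod>k\<in>Poly_Mapping.keys m'. H k ^ Poly_Mapping.lookup m' k)"
proof -
  let ?K = "Poly_Mapping.keys m \<union> Poly_Mapping.keys m'"
  \<comment> \<open>Outside its support a monomial has exponent 0 and contributes the factor 1, so
    all three products can run over the common index set \<open>?K\<close>.\<close>
  have extend: "(\<Prod>k\<in>Poly_Mapping.keys u. H k ^ Poly_Mapping.lookup u k) =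
      (\<Prod>k\<in>?K. H k ^ Poly_Mapping.lookup u k)" if "Poly_Mapping.keys u \<subseteq> ?K" for u
    using that by (intro prod.mono_neutral_left) (auto simp: in_keys_iff)
  have "(\<Prod>k\<in>Poly_Mapping.keys (m + m'). H k ^ Poly_Mapping.lookup (m + m') k) =
      (\<Prod>k\<in>?K. H k ^ Poly_Mapping.lookup m k * H k ^ Poly_Mapping.lookup m' k)"
    unfolding extend[OF keys_add] by (simp add: lookup_add power_add)
  then show ?thesis
    by (simp add: extend prod.distrib)
qed

lemma poly_mapping_sum_singles:
  "p = (\<Sum>m\<in>Poly_Mapping.keys p. Poly_Mapping.single m (Poly_Mapping.lookup p m))"
  by (rule poly_mapping_eqI)
    (auto simp: lookup_sum lookup_single when_def in_keys_iff)

text \<open>Both sides are additive in \<open>p\<close> and in \<open>q\<close>, so it suffices to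
  compare single terms.\<close>

lemma poly_subst_mult: "poly_subst H (p * q) = poly_subst H p * poly_subst H q"
proof -
  let ?s = "\<lambda>p m. Poly_Mapping.single m (Poly_Mapping.lookup p m) :: xpoly"
  have single: "poly_subst H (?s p m * ?s q m') = poly_subst H (?s p m) * poly_subst H (?s q m')"
    for m m'
    by (simp add: mult_single poly_subst_single prod_keys_add rconst_mult)
  have "p * q = (\<Sum>m\<in>Poly_Mapping.keys p. \<Sum>m'\<in>Poly_Mapping.keys q. ?s p m * ?s q m')"
    by (simp flip: sum_product poly_mapping_sum_singles)
  then have "poly_subst H (p * q) =
      (\<Sum>m\<in>Poly_Mapping.keys p. poly_subst H (?s p m)) *
      (\<Sum>m'\<in>Poly_Mapping.keys q. poly_subst H (?s q m'))"
    by (simp add: poly_subst_sum single sum_product)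
  then show ?thesis
    by (simp flip: poly_subst_sum poly_mapping_sum_singles)
qed

lemma poly_subst_pconst: "poly_subst H (pconst c) = rconst c"
  by (simp add: pconst_def poly_subst_single)

lemma poly_subst_1 [simp]: "poly_subst H 1 = 1"
  using poly_subst_pconst[of H 1] by (simp add: pconst_def)

lemma poly_subst_pvar: "poly_subst H (pvar k) = H k"
  by (simp add: pvar_def poly_subst_single)

section \<open>Substitution into fractions and composition of rational maps\<close>

text \<open>Two representing fractions are related by a cross-multiplied polynomial identity, which
  survives substitution because \<open>poly_subst\<close> is multiplicative. So the value does not
  depend on the representation.\<close>

lemma rat_subst_Fract:
  assumes "q \<noteq> 0" "poly_subst H q \<noteq> 0"
  shows "rat_subst H (Fract p q) g \<longleftrightarrow> g = poly_subst H p / poly_subst H q"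
proof
  assume "rat_subst H (Fract p q) g"
  then obtain p' q' where *: "q' \<noteq> 0" "Fract p q = Fract p' q'" "poly_subst H q' \<noteq> 0"
    "g = poly_subst H p' / poly_subst H q'"
    by (auto simp: rat_subst_def)
  have "p * q' = p' * q"
    using * assms by (simp add: eq_fract)
  then have "poly_subst H p * poly_subst H q' = poly_subst H p' * poly_subst H q"
    by (metis poly_subst_mult)
  then show "g = poly_subst H p / poly_subst H q"
    using * assms by (simp add: frac_eq_eq)
qed (use assms in \<open>auto simp: rat_subst_def\<close>)

lemma ratmap_comp_eq_Some:
  assumes "\<And>k. q k \<noteq> 0" "\<And>k. poly_subst H (q k) \<noteq> 0" "\<And>k. F k = Fract (p k) (q k)"
  shows "ratmap_comp F H = Some (\<lambda>k. poly_subst H (p k) / poly_subst H (q k))"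
proof -
  have "rat_subst H (F k) = (\<lambda>g. g = poly_subst H (p k) / poly_subst H (q k))" for k
    unfolding assms(3) using rat_subst_Fract[OF assms(1,2)] by blast
  then show ?thesis
    by (simp add: ratmap_comp_def)
qed

section \<open>The quadratic form\<close>

text \<open>Stated over any commutative ring, so that the same form can be evaluated at polynomials,
  at rational functions and at the components of a composite.\<close>

definition quad :: "nat \<Rightarrow> (nat \<times> nat \<Rightarrow> 'a::comm_ring_1) \<Rightarrow> (nat \<Rightarrow> 'a) \<Rightarrow> 'a" where
  "quad n a x = (\<Sum>i = 1..n. x i ^ 2) + (\<Sum>(i, j) \<in> index_pairs n. a (i, j) * x i * x j)"

text \<open>The coefficient of the i-th variable in \<open>quad\<close>; the two cases implement the
  convention that \<alpha> is symmetric in its indices.\<close>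

definition quad_lin :: "nat \<Rightarrow> (nat \<times> nat \<Rightarrow> 'a::comm_ring_1) \<Rightarrow> nat \<Rightarrow> (nat \<Rightarrow> 'a) \<Rightarrow> 'a" where
  "quad_lin n a i x = (\<Sum>(j, k) \<in> index_pairs n.
     if j = i then a (j, k) * x k else if k = i then a (j, k) * x j else 0)"

text \<open>In its i-th argument the form is a monic quadratic. This prepares a Vieta argument: the
  old and the new i-th coordinate will be the two roots of one quadratic equation.\<close>

lemma quad_fun_upd:
  assumes "i \<in> {1..n}"
  shows "quad n a (x(i := t)) = t\<^sup>2 + t * quad_lin n a i x + quad n a (x(i := 0))"
proof -
  have "(\<Sum>k = 1..n. (x(i := s)) k ^ 2) = s\<^sup>2 + (\<Sum>k \<in> {1..n} - {i}. x k ^ 2)" for s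
    using assms by (subst sum.remove[of _ i]) auto
  moreover have "(\<Sum>(j, k) \<in> index_pairs n. a (j, k) * (x(i := t)) j * (x(i := t)) k) =
      t * quad_lin n a i x +
      (\<Sum>(j, k) \<in> index_pairs n. a (j, k) * (x(i := 0)) j * (x(i := 0)) k)"
    unfolding quad_lin_def sum_distrib_left sum.distrib [symmetric]
    \<comment> \<open>The entries of a pair are distinct, so each summand contains at most one
      factor \<open>t\<close>.\<close>
    by (rule sum.cong) (auto simp: index_pairs_def)
  ultimately show ?thesis
    by (simp add: quad_def)
qed

text \<open>Some index other than \<open>i\<close> remains; its square is positive and all other
  terms are nonnegative.\<close>

lemma quad_fun_upd_0_pos:
  fixes x :: "nat \<Rightarrow> 'a::linordered_idom"
  assumes "n \<ge> 2" "\<And>k. k \<in> {1..n} \<Longrightarrow> 0 < x k" "\<And>p. 0 \<le> a p"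
  shows "0 < quad n a (x(i := 0))"
proof -
  obtain j where j: "j \<in> {1..n}" "j \<noteq> i"
    using assms(1) by (metis atLeastAtMost_iff le_refl numeral_2_eq_2 Suc_leD One_nat_def n_not_Suc_n)
  have "0 < (\<Sum>k = 1..n. (x(i := 0)) k ^ 2)"
    by (rule sum_pos2[of _ j]) (use j assms(2)[of j] in auto)
  moreover have "0 \<le> (\<Sum>(j, k) \<in> index_pairs n. a (j, k) * (x(i := 0)) j * (x(i := 0)) k)"
    using assms(2,3) by (intro sum_nonneg) (auto simp: index_pairs_def less_imp_le)
  ultimately show ?thesis
    by (simp add: quad_def)
qed

lemma P_poly_eq_quad: "P_poly n = quad n (\<lambda>p. pconst (alpha p)) pvar"
  by (simp add: P_poly_def quad_def)

lemma poly_subst_quad: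
  "poly_subst H (quad n (\<lambda>p. pconst (alpha p)) y) =
     quad n (\<lambda>p. rconst (alpha p)) (\<lambda>k. poly_subst H (y k))"
  by (simp add: quad_def poly_subst_add poly_subst_sum poly_subst_mult poly_subst_pconst
      power2_eq_square case_prod_unfold)

lemma to_fract_sum: "to_fract (sum f A) = (\<Sum>a\<in>A. to_fract (f a))"
  by (induction A rule: infinite_finite_induct) auto

lemma to_fract_quad: "to_fract (quad n a x) = quad n (\<lambda>p. to_fract (a p)) (\<lambda>k. to_fract (x k))"
  by (simp add: quad_def to_fract_sum power2_eq_square case_prod_unfold)

lemma F_map_eq_Fract:
  "F_map n i k = Fract ((pvar(i := quad n (\<lambda>p. pconst (alpha p)) (pvar(i := 0)))) k)
     (if k = i then pvar i else 1)"
proof -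
  have "(\<lambda>k. if k = i then 0 else rvar k) = rvar(i := 0)"
    "(\<lambda>k. to_fract (if k = i then 0 else pvar k)) = rvar(i := 0)"
    by (auto simp: rvar_def)
  then show ?thesis
    by (simp add: F_map_def Fract_conv_to_fract to_fract_quad P_poly_eq_quad poly_subst_quad
        poly_subst_pvar rvar_def [symmetric] rconst_def [symmetric])
qed

text \<open>The chosen denominators of \<open>F_map n i\<close> are the i-th variable and 1. Under
  \<open>H\<close> they become \<open>H i\<close> and 1, so a nonzero \<open>H i\<close> is enough
  for the composite to exist.\<close>

lemma ratmap_comp_F_map:
  assumes "H i \<noteq> 0"
  shows "ratmap_comp (F_map n i) H =
    Some (H(i := quad n (\<lambda>p. rconst (alpha p)) (H(i := 0)) / H i))"
proof -
  have pvar: "pvar i \<noteq> 0"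
    using rvar_nonzero[of i] by (simp add: rvar_def)
  have upd: "(\<lambda>k. poly_subst H (if k = i then 0 else pvar k)) = H(i := 0)"
    by (auto simp: poly_subst_pvar)
  show ?thesis
    by (subst ratmap_comp_eq_Some[OF _ _ F_map_eq_Fract])
      (use assms pvar in \<open>auto simp: poly_subst_pvar poly_subst_quad upd intro!: ext\<close>)
qed

section \<open>The ring of Laurent polynomials\<close>

lemma alpha_ring_0: "0 \<in> alpha_ring n"
  and alpha_ring_1: "1 \<in> alpha_ring n"
  by (simp_all add: alpha_ring_def)

lemma alpha_ring_alpha: "p \<in> index_pairs n \<Longrightarrow> alpha p \<in> alpha_ring n"
  by (simp add: alpha_ring_def alpha_def)

lemma alpha_ring_add: "a \<in> alpha_ring n \<Longrightarrow> b \<in> alpha_ring n \<Longrightarrow> a + b \<in> alpha_ring n"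
  using keys_add[of a b] by (auto simp: alpha_ring_def)

lemma alpha_ring_uminus: "a \<in> alpha_ring n \<Longrightarrow> - a \<in> alpha_ring n"
  by (simp add: alpha_ring_def in_keys_iff)

lemma alpha_ring_mult:
  assumes "a \<in> alpha_ring n" "b \<in> alpha_ring n"
  shows "a * b \<in> alpha_ring n"
  unfolding alpha_ring_def
proof (intro CollectI ballI)
  fix m assume "m \<in> Poly_Mapping.keys (a * b)"
  then obtain u v where "m = u + v" "u \<in> Poly_Mapping.keys a" "v \<in> Poly_Mapping.keys b"
    using keys_mult by blast
  then show "Poly_Mapping.keys m \<subseteq> index_pairs n"
    using assms keys_add[of u v] by (fastforce simp: alpha_ring_def)
qed

lemma laurent_polys_term:
  assumes "c \<in> alpha_ring n"
  shows "rconst c * (\<Prod>k = 1..n. rvar k powi e k) \<in> laurent_polys n"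
  unfolding laurent_polys_def
  by (intro CollectI exI[of _ "{e}"] exI[of _ "\<lambda>_. c"]) (use assms in auto)

lemma laurent_polys_rconst: "c \<in> alpha_ring n \<Longrightarrow> rconst c \<in> laurent_polys n"
  using laurent_polys_term[of c n "\<lambda>_. 0"] by simp

lemma laurent_polys_rvar_powi:
  assumes "k \<in> {1..n}"
  shows "rvar k powi z \<in> laurent_polys n"
proof -
  have "(\<Prod>j = 1..n. rvar j powi (if j = k then z else 0)) =
      (\<Prod>j = 1..n. if j = k then rvar k powi z else 1)"
    by (intro prod.cong) auto
  then show ?thesis
    using laurent_polys_term[OF alpha_ring_1, where n = n and e = "\<lambda>j. if j = k then z else 0"] assms
    by simp
qed

lemma laurent_polys_add:
  assumes "f \<in> laurent_polys n" "g \<in> laurent_polys n"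
  shows "f + g \<in> laurent_polys n"
proof -
  let ?M = "\<lambda>e. \<Prod>k = 1..n. rvar k powi e k"
  obtain E c where f: "finite E" "\<And>e. e \<in> E \<Longrightarrow> c e \<in> alpha_ring n" "f = (\<Sum>e\<in>E. rconst (c e) * ?M e)"
    using assms(1) by (auto simp: laurent_polys_def)
  obtain E' c' where g: "finite E'" "\<And>e. e \<in> E' \<Longrightarrow> c' e \<in> alpha_ring n"
    "g = (\<Sum>e\<in>E'. rconst (c' e) * ?M e)"
    using assms(2) by (auto simp: laurent_polys_def)
  \<comment> \<open>Coefficients are extended by 0 to the union of the exponent sets, so that common
    exponents are added up.\<close>
  define d where "d e = (if e \<in> E then c e else 0) + (if e \<in> E' then c' e else 0)" for e
  have "f = (\<Sum>e\<in>E \<union> E'. rconst (if e \<in> E then c e else 0) * ?M e)"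
    unfolding f by (rule sum.mono_neutral_cong_left) (use f g in auto)
  moreover have "g = (\<Sum>e\<in>E \<union> E'. rconst (if e \<in> E' then c' e else 0) * ?M e)"
    unfolding g by (rule sum.mono_neutral_cong_left) (use f g in auto)
  ultimately have "f + g = (\<Sum>e\<in>E \<union> E'. rconst (d e) * ?M e)"
    by (simp add: d_def rconst_add distrib_right sum.distrib)
  moreover have "d e \<in> alpha_ring n" for e
    using f(2) g(2) by (auto simp: d_def alpha_ring_0 intro!: alpha_ring_add)
  ultimately show ?thesis
    unfolding laurent_polys_def using f(1) g(1)
    by (intro CollectI exI[of _ "E \<union> E'"] exI[of _ d]) auto
qed

lemma laurent_polys_0: "0 \<in> laurent_polys n"
  using laurent_polys_rconst[OF alpha_ring_0] by simp

lemma laurent_polys_1: "1 \<in> laurent_polys n"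
  using laurent_polys_rconst[OF alpha_ring_1] by simp

lemma laurent_polys_sum:
  "(\<And>a. a \<in> A \<Longrightarrow> f a \<in> laurent_polys n) \<Longrightarrow> sum f A \<in> laurent_polys n"
  by (induction A rule: infinite_finite_induct) (auto simp: laurent_polys_0 laurent_polys_add)

lemma laurent_polys_mult:
  assumes "f \<in> laurent_polys n" "g \<in> laurent_polys n"
  shows "f * g \<in> laurent_polys n"
proof -
  let ?M = "\<lambda>e. \<Prod>k = 1..n. rvar k powi e k"
  obtain E c where f: "\<And>e. e \<in> E \<Longrightarrow> c e \<in> alpha_ring n" "f = (\<Sum>e\<in>E. rconst (c e) * ?M e)"
    using assms(1) by (auto simp: laurent_polys_def)
  obtain E' c' where g: "\<And>e. e \<in> E' \<Longrightarrow> c' e \<in> alpha_ring n"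
    "g = (\<Sum>e\<in>E'. rconst (c' e) * ?M e)"
    using assms(2) by (auto simp: laurent_polys_def)
  have mult_terms: "rconst (c e) * ?M e * (rconst (c' e') * ?M e') =
      rconst (c e * c' e') * ?M (\<lambda>k. e k + e' k)" for e e'
    by (simp add: rconst_mult power_int_add rvar_nonzero prod.distrib)
  \<comment> \<open>Different pairs may yield the same exponent vector; closure under sums takes
    care of such collisions.\<close>
  show ?thesis
    unfolding f(2) g(2) sum_product mult_terms
    by (intro laurent_polys_sum laurent_polys_term alpha_ring_mult f(1) g(1))
qed

lemma laurent_polys_diff:
  assumes "f \<in> laurent_polys n" "g \<in> laurent_polys n"
  shows "f - g \<in> laurent_polys n"
proof -
  have "rconst (- 1) * g \<in> laurent_polys n"
    by (intro laurent_polys_mult laurent_polys_rconst alpha_ring_uminus alpha_ring_1 assms)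
  then show ?thesis
    using laurent_polys_add[OF assms(1)] by (fastforce simp: rconst_uminus)
qed

lemma laurent_polys_prod:
  "(\<And>a. a \<in> A \<Longrightarrow> f a \<in> laurent_polys n) \<Longrightarrow> prod f A \<in> laurent_polys n"
  by (induction A rule: infinite_finite_induct) (auto simp: laurent_polys_1 laurent_polys_mult)

lemma laurent_polys_rvar: "k \<in> {1..n} \<Longrightarrow> rvar k \<in> laurent_polys n"
  using laurent_polys_rvar_powi[of k n 1] by simp

lemma laurent_polys_quad:
  assumes "\<And>k. k \<in> {1..n} \<Longrightarrow> x k \<in> laurent_polys n"
  shows "quad n (\<lambda>p. rconst (alpha p)) x \<in> laurent_polys n"
  unfolding quad_def power2_eq_square
  by (intro laurent_polys_add laurent_polys_sum)
    (auto simp: index_pairs_def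
      intro!: laurent_polys_mult laurent_polys_rconst alpha_ring_alpha assms)

lemma laurent_polys_quad_lin:
  assumes "\<And>k. k \<in> {1..n} \<Longrightarrow> x k \<in> laurent_polys n"
  shows "quad_lin n (\<lambda>p. rconst (alpha p)) i x \<in> laurent_polys n"
  unfolding quad_lin_def
  by (intro laurent_polys_sum)
    (auto simp: index_pairs_def laurent_polys_0
      intro!: laurent_polys_mult laurent_polys_rconst alpha_ring_alpha assms)

section \<open>The invariant\<close>

text \<open>Named after the Markov equation, which for n = 3 and zero \<alpha> asks this quotient to
  equal 3.\<close>

definition markov_const :: "nat \<Rightarrow> ratfun" where
  "markov_const n = quad n (\<lambda>p. rconst (alpha p)) rvar / (\<Prod>k = 1..n. rvar k)"

lemma laurent_polys_markov_const: "markov_const n \<in> laurent_polys n"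
proof -
  have "markov_const n = quad n (\<lambda>p. rconst (alpha p)) rvar * (\<Prod>k = 1..n. rvar k powi (- 1))"
    by (simp add: markov_const_def divide_inverse prod_inversef [symmetric] comp_def)
  then show ?thesis
    by (simp only:) (intro laurent_polys_mult laurent_polys_quad laurent_polys_prod
        laurent_polys_rvar laurent_polys_rvar_powi)
qed

theorem theorem1p10:
  fixes n :: nat and js :: "nat list"
  assumes "n \<ge> 3" and "set js \<subseteq> {1..n}"
  shows "\<exists>G. ratmap_comp_list (map (F_map n) js) = Some G \<and> (\<forall>k \<in> {1..n}. G k \<in> laurent_polys n)"
proof -
  let ?Q = "quad n (\<lambda>p. rconst (alpha p))"
  \<comment> \<open>The induction also carries positivity, which keeps the next denominator nonzero,
    and the invariance of \<open>markov_const n\<close> with denominators cleared.\<close>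
  have "\<exists>G. ratmap_comp_list (map (F_map n) js) = Some G \<and>
      (\<forall>k \<in> {1..n}. 0 < G k \<and> G k \<in> laurent_polys n) \<and>
      ?Q G = markov_const n * (\<Prod>k = 1..n. G k)"
    using assms(2)
  proof (induction js)
    case Nil
    have "?Q rvar = markov_const n * (\<Prod>k = 1..n. rvar k)"
      by (simp add: markov_const_def rvar_nonzero)
    then show ?case
      by (auto simp: ratmap_comp_list_def rvar_pos laurent_polys_rvar)
  next
    case (Cons i js)
    then obtain G where G: "ratmap_comp_list (map (F_map n) js) = Some G"
      "\<And>k. k \<in> {1..n} \<Longrightarrow> 0 < G k" "\<And>k. k \<in> {1..n} \<Longrightarrow> G k \<in> laurent_polys n"
      "?Q G = markov_const n * (\<Prod>k = 1..n. G k)" and i: "i \<in> {1..n}"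
      by auto
    \<comment> \<open>The map for \<open>i\<close> is applied last, so only component
      \<open>i\<close> of \<open>G\<close> changes, and \<open>t\<close> is its new value.\<close>
    define t where "t = ?Q (G(i := 0)) / G i"
    define L where "L = quad_lin n (\<lambda>p. rconst (alpha p)) i G"
    define R where "R = (\<Prod>k \<in> {1..n} - {i}. G k)"
    have Gi: "0 < G i"
      using G(2) i by blast
    have Q0: "?Q (G(i := 0)) = G i * t"
      using Gi by (simp add: t_def)
    have prod: "(\<Prod>k = 1..n. (G(i := s)) k) = s * R" for s
    proof -
      have "(\<Prod>k \<in> {1..n} - {i}. (G(i := s)) k) = R"
        unfolding R_def by (rule prod.cong) simp_all
      then show ?thesis
        using prod.remove[OF _ i, of "G(i := s)"] by simp
    qed
    \<comment> \<open>\<open>G(i := G i)\<close> is \<open>G\<close> itself, so the expansion of the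
      form can be compared with the invariant and \<open>G i\<close> cancelled. This is Vieta's
      formula for the sum of the roots.\<close>
    have "G i * (G i + L + t) = ?Q (G(i := G i))"
      unfolding quad_fun_upd[OF i, where t = "G i"] Q0 L_def by (simp add: algebra_simps power2_eq_square)
    also have "\<dots> = G i * (markov_const n * R)"
      using G(4) prod[of "G i"] by (simp add: mult_ac)
    finally have sum_roots: "G i + L + t = markov_const n * R"
      using Gi by simp
    have t_pos: "0 < t"
      unfolding t_def using Gi assms(1) G(2) rconst_alpha_pos
      by (intro divide_pos_pos quad_fun_upd_0_pos) (auto intro: less_imp_le)
    \<comment> \<open>The division by \<open>G i\<close> has disappeared, so closure of the Laurent
      polynomials under ring operations applies.\<close>
    have "t = markov_const n * R - L - G i"
      using sum_roots by (simp add: algebra_simps)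
    then have t_laurent: "t \<in> laurent_polys n"
      unfolding L_def R_def using i
      by (auto intro!: laurent_polys_diff laurent_polys_mult laurent_polys_markov_const
          laurent_polys_prod laurent_polys_quad_lin G(3))
    \<comment> \<open>The constant term \<open>G i * t\<close> and the sum
      \<open>G i + L + t\<close> are symmetric in \<open>G i\<close> and \<open>t\<close>, so the
      same expansion gives the invariant for the new tuple.\<close>
    have "?Q (G(i := t)) = t * (G i + L + t)"
      unfolding quad_fun_upd[OF i, where t = t] Q0 L_def by (simp add: algebra_simps power2_eq_square)
    also have "\<dots> = markov_const n * (\<Prod>k = 1..n. (G(i := t)) k)"
      unfolding prod sum_roots by simp
    finally have inv: "?Q (G(i := t)) = markov_const n * (\<Prod>k = 1..n. (G(i := t)) k)" .
    have "ratmap_comp_list (map (F_map n) (i # js)) = Some (G(i := t))"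
      using G(1) Gi by (simp add: ratmap_comp_list_def ratmap_comp_F_map t_def)
    moreover have "\<forall>k \<in> {1..n}. 0 < (G(i := t)) k \<and> (G(i := t)) k \<in> laurent_polys n"
      using t_pos t_laurent G(2,3) by simp
    ultimately show ?case
      using inv by blast
  qed
  then show ?thesis
    by blast
qed

end
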